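(* Let $(\mathcal{E},d,\preceq)$ be an ordered Polish space and let $P$ be a stochastically monotone Markov kernel on $\mathcal{E}$. Suppose that for any $x,y\in\mathcal{E}$ there exist two measurable sets $A_{x,y}$ and $B_{x,y}$ such that $A_{x,y}\preceq B_{x,y}$ and the following two random variables are finite almost surely: $$\tau^x_{x,y}=\inf\{n\ge 0: X_n^x\in A_{x,y}\}\quad\text{and}\quad \tau^y_{x,y}=\inf\{n\ge 0: X_n^y\in B_{x,y}\}.$$ Then the Markov chain possesses at most one stationary distribution.
   Context: An ordered Polish space is a Polish (complete separable metric) space $(\mathcal{E},d)$ with its Borel $\sigma$-algebra and a partial order $\preceq$ such that $\{(x,y): x\preceq y\}$ is closed in $\mathcal{E}\times\mathcal{E}$. For subsets $A,B\subseteq\mathcal{E}$, $A\preceq B$ means $x\preceq y$ for every $x\in A$ and $y\in B$. A Markov kernel $P(x,A)$ on $\mathcal{E}$ is a probability measure in $A$ for each $x$ and measurable in $x$ for each Borel $A$; no Feller property is assumed. $P$ is stochastically monotone if, for every measurable $g:\mathcal{E}\to[0,1]$ that is increasing ($x\preceq y\Rightarrow g(x)\le g(y)$), the function $Pg(x)=\int g(y)P(x,dy)$ is also increasing. $(X_n^x)_{n\in\mathbb{N}_0}$ denotes the time-homogeneous Markov chain with kernel $P$ and $X_0^x=x$. A stationary distribution is a probability measure $\pi$ on $\mathcal{E}$ with $\int P(x,\cdot)\,d\pi(x)=\pi$. *)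

theory Defs
  imports "HOL-Probability.Probability"
begin

text \<open>The order is an explicit relation on the type, so that it need not be the one
  of an \<open>order\<close> class instance; the class \<open>polish_space\<close> supplies the complete separable metric.\<close>

definition ordered_polish :: "('a::polish_space \<Rightarrow> 'a \<Rightarrow> bool) \<Rightarrow> bool" where
  "ordered_polish le \<longleftrightarrow>
     reflp le \<and> antisymp le \<and> transp le \<and> closed {(x, y). le x y}"

definition set_le :: "('a \<Rightarrow> 'a \<Rightarrow> bool) \<Rightarrow> 'a set \<Rightarrow> 'a set \<Rightarrow> bool" where
  "set_le le A B \<longleftrightarrow> (\<forall>x\<in>A. \<forall>y\<in>B. le x y)"

definition markov_kernel :: "('a::polish_space \<Rightarrow> 'a measure) \<Rightarrow> bool" where
  "markov_kernel P \<longleftrightarrow> P \<in> borel \<rightarrow>\<^sub>M prob_algebra borel"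

definition stochastically_monotone ::
  "('a::polish_space \<Rightarrow> 'a \<Rightarrow> bool) \<Rightarrow> ('a \<Rightarrow> 'a measure) \<Rightarrow> bool" where
  "stochastically_monotone le P \<longleftrightarrow>
     (\<forall>g :: 'a \<Rightarrow> real. g \<in> borel_measurable borel \<longrightarrow> range g \<subseteq> {0..1} \<longrightarrow>
        monotone le (\<le>) g \<longrightarrow> monotone le (\<le>) (\<lambda>x. \<integral>y. g y \<partial>P x))"

definition nat_filtration ::
  "'w measure \<Rightarrow> (nat \<Rightarrow> 'w \<Rightarrow> 'a::polish_space) \<Rightarrow> nat \<Rightarrow> 'w measure" where
  "nat_filtration M X n =
     sigma (space M) {X i -` A \<inter> space M | i A. i \<le> n \<and> A \<in> sets borel}"

text \<open>\<open>X\<close> is a time-homogeneous Markov chain with kernel \<open>P\<close> started at \<open>x\<close>, realised on \<open>M\<close>;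
  the last clause says that the conditional probability of \<open>X (Suc n) \<in> A\<close> given
  \<open>X 0, \<dots>, X n\<close> is \<open>P (X n) A\<close>.\<close>

definition markov_chain ::
  "('a::polish_space \<Rightarrow> 'a measure) \<Rightarrow> 'a \<Rightarrow> 'w measure \<Rightarrow> (nat \<Rightarrow> 'w \<Rightarrow> 'a) \<Rightarrow> bool" where
  "markov_chain P x M X \<longleftrightarrow>
     prob_space M \<and>
     (\<forall>n. X n \<in> borel_measurable M) \<and>
     (AE \<omega> in M. X 0 \<omega> = x) \<and>
     (\<forall>n. \<forall>A \<in> sets borel. AE \<omega> in M.
        real_cond_exp M (nat_filtration M X n) (indicat_real (X (Suc n) -` A \<inter> space M)) \<omega>
          = measure (P (X n \<omega>)) A)"

definition hitting_time :: "(nat \<Rightarrow> 'w \<Rightarrow> 'a) \<Rightarrow> 'a set \<Rightarrow> 'w \<Rightarrow> enat" where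
  "hitting_time X A \<omega> = Inf (enat ` {n. X n \<omega> \<in> A})"

definition stationary_distribution ::
  "('a::polish_space \<Rightarrow> 'a measure) \<Rightarrow> 'a measure \<Rightarrow> bool" where
  "stationary_distribution P \<pi> \<longleftrightarrow> \<pi> \<in> space (prob_algebra borel) \<and> \<pi> \<bind> P = \<pi>"

end

theory Submission imports Defs begin

text \<open>
  Let \<open>\<pi>\<close> and \<open>\<rho>\<close> be stationary. It suffices to show \<open>\<integral> g d\<pi> \<le> \<integral> g d\<rho>\<close> for all increasing measurable
  \<open>g\<close> with values in \<open>[0, 1]\<close>: by symmetry \<open>\<pi>\<close> and \<open>\<rho>\<close> then agree on all Borel upper sets, and such
  sets determine a Borel probability measure
  (\<open>prob_measures_eq_if_eq_on_upper_sets\<close>). The latter holds because every compact set lies in the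
  \<open>\<sigma>\<close>-algebra generated by the Borel upper sets: saturations of compact sets under the closed order
  are closed, and they separate points.

  For the inequality, consider the time averages \<open>G\<^sub>N = (g + P g + \<dots> + P\<^sup>N\<^sup>-\<^sup>1 g) / N\<close>. They are
  increasing, by stochastic monotonicity; they are harmonic for \<open>P\<close> up to an error \<open>1 / N\<close>; and their
  integral with respect to a stationary distribution is that of \<open>g\<close>. Fix \<open>x\<close> and \<open>y\<close> with
  their sets \<open>A\<close> and \<open>B\<close>. As \<open>A\<close> lies below \<open>B\<close>, a number \<open>c\<close> satisfies \<open>G\<^sub>N \<le> c\<close> on \<open>A\<close> and
  \<open>c \<le> G\<^sub>N\<close> on \<open>B\<close>. Near-harmonicity carries the first bound back from \<open>A\<close> to \<open>x\<close>, and the second from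
  \<open>B\<close> to \<open>y\<close>: stopping the chain when it enters the set, or else after \<open>k\<close> steps, costs at most \<open>k / N\<close>
  plus the probability of not having entered by time \<open>k\<close> (\<open>bound_by_avoid\<close>). That the two chains
  enter their sets at different random times does no harm, because \<open>G\<^sub>N\<close> is insensitive to shifts of
  time. Both hitting times being finite, the positive part of \<open>G\<^sub>N x - G\<^sub>N y\<close> tends to \<open>0\<close> as \<open>N\<close> grows
  (\<open>cesaro_diff_pos_part_tendsto_0\<close>). Integrating against the product of \<open>\<pi>\<close> and \<open>\<rho>\<close> gives
  \<open>\<integral> g d\<pi> - \<integral> g d\<rho> \<le> 0\<close> (\<open>integral_le_of_avoid_tendsto_0\<close>).
\<close>

section \<open>Upper sets determine Borel probability measures\<close>

text \<open>Borel upper sets are the sets whose indicators are measurable increasing functions; they are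
  therefore the test sets to which stochastic monotonicity applies.\<close>
definition upper_sets :: "('a::topological_space \<Rightarrow> 'a \<Rightarrow> bool) \<Rightarrow> 'a set set" where
  "upper_sets le = {U \<in> sets borel. \<forall>x y. x \<in> U \<longrightarrow> le x y \<longrightarrow> y \<in> U}"

text \<open>Compactness of \<open>C\<close> supplies a convergent subsequence of the first coordinates, so a limit of
  second coordinates still has a partner in \<open>C\<close>. For a merely closed or Borel set \<open>C\<close> the image
  could be non-Borel, which is why everything below starts from compact sets.\<close>
lemma closed_Image_compact:
  fixes R :: "('a::metric_space \<times> 'b::metric_space) set"
  assumes "closed R" "compact C"
  shows "closed (R `` C)"
  unfolding closed_sequential_limits
proof (intro allI impI, elim conjE)
  fix y l assume y: "\<forall>n. y n \<in> R `` C" and l: "y \<longlonglongrightarrow> l"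
  have "\<forall>n. \<exists>x. x \<in> C \<and> (x, y n) \<in> R" using y by blast
  then obtain x where x: "\<And>n. x n \<in> C" "\<And>n. (x n, y n) \<in> R" by metis
  obtain a r where a: "a \<in> C" "strict_mono r" "(x \<circ> r) \<longlonglongrightarrow> a"
    using \<open>compact C\<close> x(1) unfolding compact_def by metis
  have "(\<lambda>n. ((x \<circ> r) n, (y \<circ> r) n)) \<longlonglongrightarrow> (a, l)"
    by (intro tendsto_Pair a(3) LIMSEQ_subseq_LIMSEQ[OF l a(2)])
  moreover have "((x \<circ> r) n, (y \<circ> r) n) \<in> R" for n
    using x by simp
  ultimately have "(a, l) \<in> R"
    by (rule closed_sequentially[OF \<open>closed R\<close>, rotated])
  then show "l \<in> R `` C" using a by auto
qed

lemma ordered_polish_converse: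
  fixes le :: "'a::polish_space \<Rightarrow> 'a \<Rightarrow> bool"
  assumes "ordered_polish le"
  shows "ordered_polish (\<lambda>x y. le y x)"
proof -
  have cl: "closed {(x, y). le x y}" using assms unfolding ordered_polish_def by blast
  have "{(x, y). le y x} = prod.swap -` {(x, y). le x y}" by auto
  moreover have "continuous_on UNIV (prod.swap :: 'a \<times> 'a \<Rightarrow> _)"
    by (rule continuous_on_swap)
  ultimately have "closed {(x, y). le y x}"
    by (simp only: closed_vimage[OF cl])
  then show ?thesis
    using assms unfolding ordered_polish_def reflp_def antisymp_def transp_def by blast
qed

lemma closed_order_saturation:
  fixes le :: "'a::polish_space \<Rightarrow> 'a \<Rightarrow> bool"
  assumes "ordered_polish le" "compact C"
  shows "closed {y. \<exists>x\<in>C. le x y}"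
proof -
  have "{(x, y). le x y} `` C = {y. \<exists>x\<in>C. le x y}" by auto
  then show ?thesis
    using closed_Image_compact[of "{(x, y). le x y}" C] assms
    by (simp add: ordered_polish_def)
qed

text \<open>The upward saturation of a compact set is itself a Borel upper set, and the downward
  saturation is the complement of one.\<close>
lemma order_saturation_in_sigma_upper_sets:
  fixes le :: "'a::polish_space \<Rightarrow> 'a \<Rightarrow> bool"
  assumes le: "ordered_polish le" and C: "compact C"
  shows "{y. \<exists>x\<in>C. le x y} \<in> sigma_sets UNIV (upper_sets le)"
    and "{y. \<exists>x\<in>C. le y x} \<in> sigma_sets UNIV (upper_sets le)"
proof -
  have tr: "\<And>x y z. le x y \<Longrightarrow> le y z \<Longrightarrow> le x z"
    using le unfolding ordered_polish_def by (meson transpD)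
  have "{y. \<exists>x\<in>C. le x y} \<in> sets borel"
    using closed_order_saturation[OF le C] by (rule borel_closed)
  then have "{y. \<exists>x\<in>C. le x y} \<in> upper_sets le"
    unfolding upper_sets_def using tr by blast
  then show "{y. \<exists>x\<in>C. le x y} \<in> sigma_sets UNIV (upper_sets le)"
    by (rule sigma_sets.Basic)
  have "- {y. \<exists>x\<in>C. le y x} \<in> sets borel"
    using closed_order_saturation[OF ordered_polish_converse[OF le] C]
    by (intro borel_comp borel_closed)
  then have "- {y. \<exists>x\<in>C. le y x} \<in> upper_sets le"
    unfolding upper_sets_def using tr by blast
  then have "UNIV - (- {y. \<exists>x\<in>C. le y x}) \<in> sigma_sets UNIV (upper_sets le)"
    by (intro sigma_sets.Compl sigma_sets.Basic)
  then show "{y. \<exists>x\<in>C. le y x} \<in> sigma_sets UNIV (upper_sets le)"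
    by (simp only: Diff_eq double_complement Int_UNIV_left)
qed

text \<open>Since the order is closed, \<open>\<not> le x y\<close> persists on a product of neighbourhoods of \<open>x\<close> and \<open>y\<close>.
  Saturating the part of \<open>F\<close> in a small closed ball around \<open>x\<close> then stays clear of the
  neighbourhood of \<open>y\<close>, and by reflexivity it contains that part of \<open>F\<close>.\<close>
lemma not_le_imp_saturation_separates:
  fixes le :: "'a::polish_space \<Rightarrow> 'a \<Rightarrow> bool"
  assumes le: "ordered_polish le" and "\<not> le x y" "compact F"
  obtains V U C where "open V" "x \<in> V" "open U" "y \<in> U" "compact C"
    "F \<inter> V \<subseteq> {z. \<exists>c\<in>C. le c z}" "{z. \<exists>c\<in>C. le c z} \<inter> U = {}"
proof -
  have cl: "closed {(x, y). le x y}" and re: "\<And>z. le z z"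
    using le unfolding ordered_polish_def reflp_def by blast+
  have "open (- {(x, y). le x y})" "(x, y) \<in> - {(x, y). le x y}"
    using cl \<open>\<not> le x y\<close> by (simp_all add: open_Compl)
  then obtain V U where VU: "open V" "open U" "(x, y) \<in> V \<times> U" "V \<times> U \<subseteq> - {(x, y). le x y}"
    by (rule open_prod_elim)
  then have sep: "\<not> le v u" if "v \<in> V" "u \<in> U" for v u using that by auto
  from VU(3) have "x \<in> V" "y \<in> U" by simp_all
  obtain r where r: "r > 0" "cball x r \<subseteq> V"
    using VU(1) \<open>x \<in> V\<close> open_contains_cball by metis
  show ?thesis
  proof (rule that)
    show "open (ball x r)" "x \<in> ball x r" using r(1) by simp_all
    show "compact (F \<inter> cball x r)"
      using \<open>compact F\<close> closed_cball by (rule compact_Int_closed)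
    show "F \<inter> ball x r \<subseteq> {z. \<exists>c\<in>F \<inter> cball x r. le c z}"
    proof
      fix z assume "z \<in> F \<inter> ball x r"
      then have "z \<in> F \<inter> cball x r" by simp
      then show "z \<in> {z. \<exists>c\<in>F \<inter> cball x r. le c z}" using re by blast
    qed
    show "{z. \<exists>c\<in>F \<inter> cball x r. le c z} \<inter> U = {}" using sep r(2) by blast
  qed (fact \<open>open U\<close> \<open>y \<in> U\<close>)+
qed

text \<open>By antisymmetry, distinct points fail to be related in at least one direction; this decides
  whether an upward or a downward saturation separates them.\<close>
lemma separate_point_from_point:
  fixes le :: "'a::polish_space \<Rightarrow> 'a \<Rightarrow> bool"
  assumes le: "ordered_polish le" and "x \<noteq> y" "compact F"
  obtains V U S where "open V" "x \<in> V" "open U" "y \<in> U"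
    "S \<in> sigma_sets UNIV (upper_sets le)" "F \<inter> V \<subseteq> S" "S \<inter> U = {}"
proof (cases "le x y")
  case True
  with \<open>x \<noteq> y\<close> le have "\<not> le y x" unfolding ordered_polish_def by (meson antisympD)
  then show ?thesis
    by (rule not_le_imp_saturation_separates[OF ordered_polish_converse[OF le] _ \<open>compact F\<close>])
       (erule (3) that[OF _ _ _ _ order_saturation_in_sigma_upper_sets(2)[OF le]])
next
  case False
  then show ?thesis
    by (rule not_le_imp_saturation_separates[OF le _ \<open>compact F\<close>])
       (erule (3) that[OF _ _ _ _ order_saturation_in_sigma_upper_sets(1)[OF le]])
qed

text \<open>Finitely many of the neighbourhoods from \<open>separate_point_from_point\<close> cover \<open>F\<close>. The sets
  around \<open>F\<close> are united and the neighbourhoods of \<open>y\<close> are intersected.\<close>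
lemma separate_compact_from_point:
  fixes le :: "'a::polish_space \<Rightarrow> 'a \<Rightarrow> bool"
  assumes le: "ordered_polish le" and "compact F" "y \<notin> F"
  obtains S U where "open U" "y \<in> U" "S \<in> sigma_sets UNIV (upper_sets le)" "F \<subseteq> S" "S \<inter> U = {}"
proof -
  let ?\<Sigma> = "sigma_sets UNIV (upper_sets le)"
  define separable where "separable A \<longleftrightarrow>
    (\<exists>U S. open U \<and> y \<in> U \<and> S \<in> ?\<Sigma> \<and> F \<inter> A \<subseteq> S \<and> S \<inter> U = {})" for A
  have separableI: "separable A"
    if "open U" "y \<in> U" "S \<in> ?\<Sigma>" "F \<inter> A \<subseteq> S" "S \<inter> U = {}" for A U S
    unfolding separable_def using that by blast
  have "F \<subseteq> \<Union>{V. open V \<and> separable V}"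
  proof
    fix x assume "x \<in> F"
    then have "x \<noteq> y" using \<open>y \<notin> F\<close> by blast
    then obtain V U S where "open V" "x \<in> V" "open U" "y \<in> U" "S \<in> ?\<Sigma>" "F \<inter> V \<subseteq> S" "S \<inter> U = {}"
      by (rule separate_point_from_point[OF le _ \<open>compact F\<close>])
    then have "separable V" by (intro separableI[of U S])
    with \<open>open V\<close> \<open>x \<in> V\<close> show "x \<in> \<Union>{V. open V \<and> separable V}" by blast
  qed
  then obtain D where D: "D \<subseteq> {V. open V \<and> separable V}" "finite D" "F \<subseteq> \<Union>D"
    by (rule compactE[OF \<open>compact F\<close>]) simp_all
  from D(2,1) have "separable (\<Union>D)"
  proof (induction D)
    case empty
    show ?case by (rule separableI[of UNIV "{}"]) (simp_all add: sigma_sets.Empty)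
  next
    case (insert V D)
    then have "separable V" "separable (\<Union>D)" by simp_all
    then obtain U\<^sub>1 S\<^sub>1 U\<^sub>2 S\<^sub>2
      where 1: "open U\<^sub>1" "y \<in> U\<^sub>1" "S\<^sub>1 \<in> ?\<Sigma>" "F \<inter> V \<subseteq> S\<^sub>1" "S\<^sub>1 \<inter> U\<^sub>1 = {}"
        and 2: "open U\<^sub>2" "y \<in> U\<^sub>2" "S\<^sub>2 \<in> ?\<Sigma>" "F \<inter> \<Union>D \<subseteq> S\<^sub>2" "S\<^sub>2 \<inter> U\<^sub>2 = {}"
      unfolding separable_def by (elim exE conjE)
    show ?case
    proof (rule separableI)
      show "open (U\<^sub>1 \<inter> U\<^sub>2)" using 1(1) 2(1) by (rule open_Int)
      show "S\<^sub>1 \<union> S\<^sub>2 \<in> ?\<Sigma>" using 1(3) 2(3) by (rule sigma_sets_Un)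
      show "y \<in> U\<^sub>1 \<inter> U\<^sub>2" using 1(2) 2(2) by (rule IntI)
      show "F \<inter> \<Union>(insert V D) \<subseteq> S\<^sub>1 \<union> S\<^sub>2" using 1(4) 2(4) by blast
      show "(S\<^sub>1 \<union> S\<^sub>2) \<inter> (U\<^sub>1 \<inter> U\<^sub>2) = {}" using 1(5) 2(5) by blast
    qed
  qed
  then obtain U S where "open U" "y \<in> U" "S \<in> ?\<Sigma>" "F \<inter> \<Union>D \<subseteq> S" "S \<inter> U = {}"
    unfolding separable_def by (elim exE conjE)
  moreover from D(3) \<open>F \<inter> \<Union>D \<subseteq> S\<close> have "F \<subseteq> S" by blast
  ultimately show ?thesis by (intro that[of U S])
qed

text \<open>The open sets that can be cut off from \<open>F\<close> by a set of the \<open>\<sigma>\<close>-algebra cover the complement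
  of \<open>F\<close>. Countably many of them suffice, by second countability, and the intersection of the
  corresponding sets of the \<open>\<sigma>\<close>-algebra is exactly \<open>F\<close>.\<close>
lemma compact_in_sigma_upper_sets:
  fixes le :: "'a::polish_space \<Rightarrow> 'a \<Rightarrow> bool"
  assumes le: "ordered_polish le" and F: "compact F"
  shows "F \<in> sigma_sets UNIV (upper_sets le)"
proof -
  let ?\<Sigma> = "sigma_sets UNIV (upper_sets le)"
  define \<U> where "\<U> = {U. open U \<and> (\<exists>S\<in>?\<Sigma>. F \<subseteq> S \<and> S \<inter> U = {})}"
  have cover: "\<Union>\<U> = - F"
  proof (intro equalityI subsetI)
    fix y assume "y \<in> - F"
    then have "y \<notin> F" by simp
    then obtain S U where "open U" "y \<in> U" "S \<in> ?\<Sigma>" "F \<subseteq> S" "S \<inter> U = {}"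
      by (rule separate_compact_from_point[OF le F])
    then show "y \<in> \<Union>\<U>" unfolding \<U>_def by (intro UnionI[of U] CollectI conjI bexI[of _ S])
  next
    fix y assume "y \<in> \<Union>\<U>"
    then show "y \<in> - F" unfolding \<U>_def by blast
  qed
  obtain \<V> where \<V>: "\<V> \<subseteq> \<U>" "countable \<V>" "\<Union>\<V> = \<Union>\<U>"
    by (rule Lindelof[of \<U>]) (simp_all add: \<U>_def)
  have "\<forall>U\<in>\<V>. \<exists>S. S \<in> ?\<Sigma> \<and> F \<subseteq> S \<and> S \<inter> U = {}"
    using \<V>(1) unfolding \<U>_def by blast
  from bchoice[OF this]
  obtain S where "\<forall>U\<in>\<V>. S U \<in> ?\<Sigma> \<and> F \<subseteq> S U \<and> S U \<inter> U = {}" by (rule exE)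
  then have S: "\<And>U. U \<in> \<V> \<Longrightarrow> S U \<in> ?\<Sigma>" "\<And>U. U \<in> \<V> \<Longrightarrow> F \<subseteq> S U"
    "\<And>U. U \<in> \<V> \<Longrightarrow> S U \<inter> U = {}" by simp_all
  interpret sigma_algebra UNIV ?\<Sigma>
    by (rule sigma_algebra_sigma_sets) simp
  have "(\<Inter>U\<in>\<V>. S U) = F"
  proof (rule equalityI)
    have "- F = \<Union>\<V>" using \<V>(3) cover by (rule trans[THEN sym])
    then show "(\<Inter>U\<in>\<V>. S U) \<subseteq> F" using S(3) by blast
    show "F \<subseteq> (\<Inter>U\<in>\<V>. S U)" using S(2) by (rule INT_greatest)
  qed
  moreover have "(\<Union>U\<in>\<V>. UNIV - S U) \<in> ?\<Sigma>"
    by (intro countable_UN' \<V>(2) image_subsetI sigma_sets.Compl S(1))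
  then have "UNIV - (\<Union>U\<in>\<V>. UNIV - S U) \<in> ?\<Sigma>" by (rule sigma_sets.Compl)
  moreover have "UNIV - (\<Union>U\<in>\<V>. UNIV - S U) = (\<Inter>U\<in>\<V>. S U)" by auto
  ultimately show ?thesis by simp
qed

text \<open>Borel upper sets are closed under intersection, so agreement on them extends to the
  \<open>\<sigma>\<close>-algebra that they generate. This contains all compact sets, and finite Borel measures on a
  Polish space are determined by their values on compact sets.\<close>
theorem prob_measures_eq_if_eq_on_upper_sets:
  fixes le :: "'a::polish_space \<Rightarrow> 'a \<Rightarrow> bool"
  assumes le: "ordered_polish le"
    and \<mu>: "\<mu> \<in> space (prob_algebra borel)" and \<nu>: "\<nu> \<in> space (prob_algebra borel)"
    and eq: "\<And>U. U \<in> upper_sets le \<Longrightarrow> measure \<mu> U = measure \<nu> U"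
  shows "\<mu> = \<nu>"
proof -
  interpret \<mu>: prob_space \<mu> using \<mu> by (simp add: space_prob_algebra)
  interpret \<nu>: prob_space \<nu> using \<nu> by (simp add: space_prob_algebra)
  have s [simp]: "sets \<mu> = sets borel" "sets \<nu> = sets borel"
    using \<mu> \<nu> by (auto simp: space_prob_algebra)
  have sp [simp]: "space \<mu> = UNIV" "space \<nu> = UNIV"
    using s[THEN sets_eq_imp_space_eq] by (simp_all only: space_borel)
  have sub: "sigma_sets UNIV (upper_sets le) \<subseteq> sets borel"
  proof -
    have "upper_sets le \<subseteq> sets borel" unfolding upper_sets_def by (rule Collect_restrict)
    from sets.sigma_sets_subset[OF this] show ?thesis by (simp only: space_borel)
  qed
  have on_sigma: "measure \<mu> S = measure \<nu> S" if "S \<in> sigma_sets UNIV (upper_sets le)" for S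
  proof (rule sigma_sets_induct_disjoint[OF _ _ that])
    show "Int_stable (upper_sets le)"
    proof (rule Int_stableI)
      fix U V assume "U \<in> upper_sets le" "V \<in> upper_sets le"
      then show "U \<inter> V \<in> upper_sets le"
        unfolding upper_sets_def mem_Collect_eq by (intro conjI sets.Int) blast+
    qed
    show "upper_sets le \<subseteq> Pow UNIV" by simp
    show "measure \<mu> (UNIV - A) = measure \<nu> (UNIV - A)"
      if "A \<in> sigma_sets UNIV (upper_sets le)" "measure \<mu> A = measure \<nu> A" for A
    proof -
      have "A \<in> sets borel" using that(1) sub by (rule rev_subsetD)
      then show ?thesis using \<mu>.prob_compl[of A] \<nu>.prob_compl[of A] that(2) by simp
    qed
    show "measure \<mu> (\<Union>i. A i) = measure \<nu> (\<Union>i. A i)"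
      if "disjoint_family A" "range A \<subseteq> sigma_sets UNIV (upper_sets le)"
        "\<And>i. measure \<mu> (A i) = measure \<nu> (A i)" for A :: "nat \<Rightarrow> 'a set"
    proof -
      have A: "range A \<subseteq> sets borel" using that(2) sub by (rule order_trans)
      have "(\<lambda>i. measure \<mu> (A i)) sums measure \<mu> (\<Union>i. A i)"
        using A that(1) by (intro \<mu>.finite_measure_UNION) simp_all
      moreover have "(\<lambda>i. measure \<nu> (A i)) sums measure \<nu> (\<Union>i. A i)"
        using A that(1) by (intro \<nu>.finite_measure_UNION) simp_all
      ultimately show ?thesis unfolding that(3) by (rule sums_unique2)
    qed
  qed (simp_all add: eq)
  have on_compact: "emeasure \<mu> K = emeasure \<nu> K" if "compact K" for K
    unfolding \<mu>.emeasure_eq_measure \<nu>.emeasure_eq_measure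
    using on_sigma[OF compact_in_sigma_upper_sets[OF le that]] by simp
  show ?thesis
  proof (rule measure_eqI)
    fix B assume "B \<in> sets \<mu>"
    then have B: "B \<in> sets borel" by simp
    have "emeasure \<mu> B = (SUP K \<in> {K. K \<subseteq> B \<and> compact K}. emeasure \<mu> K)"
      by (rule inner_regular[OF s(1) _ B]) simp
    also have "\<dots> = (SUP K \<in> {K. K \<subseteq> B \<and> compact K}. emeasure \<nu> K)"
      by (rule SUP_cong[OF refl]) (simp add: on_compact)
    also have "\<dots> = emeasure \<nu> B"
      by (rule inner_regular[OF s(2) _ B, symmetric]) simp
    finally show "emeasure \<mu> B = emeasure \<nu> B" .
  qed simp
qed

section \<open>The Markov operator on functions with values in the unit interval\<close>

definition kernel_op :: "('a \<Rightarrow> 'a measure) \<Rightarrow> ('a \<Rightarrow> real) \<Rightarrow> 'a \<Rightarrow> real" where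
  "kernel_op P f x = (\<integral>y. f y \<partial>P x)"

definition unit_functions :: "('a::topological_space \<Rightarrow> real) set" where
  "unit_functions = {f \<in> borel_measurable borel. range f \<subseteq> {0..1}}"

lemma unit_functionsI:
  "f \<in> borel_measurable borel \<Longrightarrow> (\<And>x. 0 \<le> f x) \<Longrightarrow> (\<And>x. f x \<le> 1) \<Longrightarrow> f \<in> unit_functions"
  by (auto simp: unit_functions_def)

lemma unit_functionsD:
  assumes "f \<in> unit_functions"
  shows "f \<in> borel_measurable borel" "0 \<le> f x" "f x \<le> 1"
  using assms by (simp_all add: unit_functions_def image_subset_iff)

lemma indicator_unit: "A \<in> sets borel \<Longrightarrow> indicat_real A \<in> unit_functions"
  by (intro unit_functionsI) simp_all

lemma integrable_unit_function:
  assumes "finite_measure M" "sets M = sets borel" "f \<in> unit_functions"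
  shows "integrable M f"
proof -
  interpret finite_measure M by fact
  have "f \<in> borel_measurable M"
    using unit_functionsD(1)[OF assms(3)] by (simp add: measurable_cong_sets[OF assms(2) refl])
  moreover have "norm (f x) \<le> 1" for x
    using unit_functionsD(2,3)[OF assms(3), of x] by simp
  ultimately show ?thesis by (intro integrable_const_bound[where B=1]) simp_all
qed

locale kernel =
  fixes P :: "'a::polish_space \<Rightarrow> 'a measure"
  assumes kernel: "markov_kernel P"
begin

lemma prob_space_kernel: "prob_space (P x)" and sets_kernel: "sets (P x) = sets borel"
  using measurable_space[OF kernel[unfolded markov_kernel_def], of x]
  by (simp_all add: space_prob_algebra)

lemma kernel_subprob: "P \<in> borel \<rightarrow>\<^sub>M subprob_algebra borel"
  using kernel unfolding markov_kernel_def by (rule measurable_prob_algebraD)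

lemma integrable_kernel: "f \<in> unit_functions \<Longrightarrow> integrable (P x) f"
  by (rule integrable_unit_function[OF prob_space.finite_measure[OF prob_space_kernel] sets_kernel])

lemma kernel_op_unit:
  assumes "f \<in> unit_functions"
  shows "kernel_op P f \<in> unit_functions"
proof (rule unit_functionsI)
  have "(\<lambda>x. integral\<^sup>L (P x) f) \<in> borel_measurable borel"
    by (rule measurable_compose[OF kernel_subprob])
       (rule integral_measurable_subprob_algebra[OF unit_functionsD(1)[OF assms]])
  then show "kernel_op P f \<in> borel_measurable borel"
    by (simp add: kernel_op_def[abs_def])
  fix x
  interpret prob_space "P x" by (rule prob_space_kernel)
  show "0 \<le> kernel_op P f x"
    unfolding kernel_op_def by (intro integral_nonneg_AE AE_I2 unit_functionsD(2)[OF assms])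
  show "kernel_op P f x \<le> 1"
    unfolding kernel_op_def
    by (intro integral_le_const integrable_kernel assms AE_I2 unit_functionsD(3))
qed

lemma kernel_op_indicator:
  assumes "A \<in> sets borel"
  shows "kernel_op P (indicat_real A) x = measure (P x) A"
  using assms sets_kernel[of x] sets_eq_imp_space_eq[OF sets_kernel, of x]
  by (simp add: kernel_op_def)

lemma kernel_pow_unit: "f \<in> unit_functions \<Longrightarrow> (kernel_op P ^^ n) f \<in> unit_functions"
  by (induction n) (simp_all add: kernel_op_unit)

text \<open>The duality between the action of \<open>P\<close> on measures and on functions.\<close>
lemma integral_bind_kernel:
  assumes M: "finite_measure M" "sets M = sets borel" and f: "f \<in> unit_functions"
  shows "(\<integral>y. f y \<partial>(M \<bind> P)) = (\<integral>x. kernel_op P f x \<partial>M)"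
  unfolding kernel_op_def
proof (rule integral_bind[where K=borel and B=1 and B'=1])
  show "f \<in> borel_measurable borel" using f by (rule unit_functionsD)
  show "\<bar>f x\<bar> \<le> 1" for x using unit_functionsD(2,3)[OF f, of x] by simp
  show "P \<in> M \<rightarrow>\<^sub>M subprob_algebra borel"
    using kernel_subprob by (simp add: measurable_cong_sets[OF M(2) refl])
  show "finite_measure M" by (rule M(1))
  show "AE x in M. emeasure (P x) (space (P x)) \<le> ennreal 1"
    using prob_space.emeasure_space_1[OF prob_space_kernel] by simp
qed

section \<open>Avoidance probabilities and a maximum principle\<close>

text \<open>The probability that the chain started at the given point is outside \<open>A\<close> at all times
  \<open>0, \<dots>, k\<close>, computed backwards by conditioning on the first step. The recursion refers to the
  kernel alone, so that no path space is needed to work with hitting times; the link with an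
  actual chain is \<open>avoid_eq_prob\<close>.\<close>
primrec avoid :: "'a set \<Rightarrow> nat \<Rightarrow> 'a \<Rightarrow> real" where
  "avoid A 0 = indicator (- A)"
| "avoid A (Suc k) = (\<lambda>x. indicator (- A) x * kernel_op P (avoid A k) x)"

lemma avoid_unit:
  assumes A: "A \<in> sets borel"
  shows "avoid A k \<in> unit_functions"
proof (induction k)
  have ind: "indicator (- A) \<in> borel_measurable borel"
    using A by (intro borel_measurable_indicator borel_comp)
  case 0
  show ?case unfolding avoid.simps using ind by (rule unit_functionsI) simp_all
  case (Suc k)
  note U = unit_functionsD[OF kernel_op_unit[OF Suc.IH]]
  show ?case unfolding avoid.simps
    by (intro unit_functionsI borel_measurable_times ind U(1) mult_nonneg_nonneg mult_le_one
        U(2,3) indicator_pos_le indicator_le_1)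
qed

text \<open>A maximum principle. Run the chain from \<open>x\<close> until it enters \<open>A\<close>, but for at most \<open>k\<close> steps: each
  step costs at most \<open>d\<close>, in \<open>A\<close> the function is at most \<open>c\<close>, and if \<open>A\<close> has not been reached the
  trivial bound \<open>1\<close> is used. It takes the place of the strong Markov property at the
  hitting time.\<close>
lemma bound_by_avoid:
  assumes A: "A \<in> sets borel" and h: "h \<in> unit_functions" and c: "0 \<le> c" and d: "0 \<le> d"
    and on: "\<And>x. x \<in> A \<Longrightarrow> h x \<le> c" and step: "\<And>x. h x \<le> d + kernel_op P h x"
  shows "h x \<le> c + real k * d + avoid A k x"
proof (induction k arbitrary: x)
  case 0
  show ?case using on[of x] unit_functionsD(3)[OF h, of x] c by (cases "x \<in> A") simp_all
next
  case (Suc k)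
  show ?case
  proof (cases "x \<in> A")
    case True
    then have "avoid A (Suc k) x = 0" by simp
    moreover have "0 \<le> real (Suc k) * d" using d by simp
    ultimately show ?thesis using on[OF True] by linarith
  next
    case False
    interpret prob_space "P x" by (rule prob_space_kernel)
    have i: "integrable (P x) (avoid A k)" by (intro integrable_kernel avoid_unit A)
    have "h x \<le> d + kernel_op P h x" by (rule step)
    also have "kernel_op P h x \<le> (\<integral>y. (c + real k * d) + avoid A k y \<partial>P x)"
      unfolding kernel_op_def
      by (intro integral_mono integrable_kernel h Bochner_Integration.integrable_add
          integrable_const i Suc.IH)
    also have "\<dots> = (c + real k * d) + kernel_op P (avoid A k) x"
      using i by (simp add: kernel_op_def prob_space)
    finally show ?thesis using False by (simp add: algebra_simps)
  qed
qed

section \<open>Time averages of an increasing function\<close>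

text \<open>Averaging over time is what makes two chains comparable that enter their target sets at
  different times: a shift of time by a bounded amount changes \<open>P\<^sup>n g\<close> uncontrollably, but the
  average over \<open>N\<close> times only by a term of order \<open>1 / N\<close>. For \<open>N = 0\<close> the value is \<open>0\<close>.\<close>
definition cesaro :: "('a \<Rightarrow> real) \<Rightarrow> nat \<Rightarrow> 'a \<Rightarrow> real" where
  "cesaro g N x = (\<Sum>n<N. (kernel_op P ^^ n) g x) / real N"

lemma cesaro_unit:
  assumes "g \<in> unit_functions"
  shows "cesaro g N \<in> unit_functions"
proof (rule unit_functionsI)
  note U = unit_functionsD[OF kernel_pow_unit[OF assms]]
  show "cesaro g N \<in> borel_measurable borel"
    unfolding cesaro_def[abs_def] by (intro borel_measurable_divide borel_measurable_sum U(1) borel_measurable_const)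
  fix x
  show "0 \<le> cesaro g N x"
    unfolding cesaro_def by (intro divide_nonneg_nonneg sum_nonneg U(2)) simp
  have "(\<Sum>n<N. (kernel_op P ^^ n) g x) \<le> real (card {..<N}) * 1"
    by (rule sum_bounded_above) (rule U(3))
  then show "cesaro g N x \<le> 1"
    unfolding cesaro_def by (cases "N = 0") (simp_all add: divide_le_eq)
qed

lemma kernel_op_cesaro:
  assumes g: "g \<in> unit_functions"
  shows "kernel_op P (cesaro g N) x = (\<Sum>n<N. (kernel_op P ^^ Suc n) g x) / real N"
proof -
  have "kernel_op P (cesaro g N) x = (\<Sum>n<N. \<integral>y. (kernel_op P ^^ n) g y \<partial>P x) / real N"
    unfolding kernel_op_def cesaro_def[abs_def] integral_divide_zero
    by (subst Bochner_Integration.integral_sum)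
       (simp_all add: integrable_kernel kernel_pow_unit[OF g] flip: kernel_op_def)
  then show ?thesis by (simp add: kernel_op_def)
qed

text \<open>The two sums differ only in their first and last terms.\<close>
lemma cesaro_almost_harmonic:
  assumes g: "g \<in> unit_functions"
  shows "\<bar>cesaro g N x - kernel_op P (cesaro g N) x\<bar> \<le> 1 / real N"
proof -
  let ?a = "\<lambda>n. (kernel_op P ^^ n) g x"
  have "cesaro g N x - kernel_op P (cesaro g N) x = (\<Sum>n<N. ?a n - ?a (Suc n)) / real N"
    unfolding kernel_op_cesaro[OF g] unfolding cesaro_def
    by (simp only: sum_subtractf diff_divide_distrib)
  also have "(\<Sum>n<N. ?a n - ?a (Suc n)) = ?a 0 - ?a N"
    by (rule sum_lessThan_telescope')
  finally have "\<bar>cesaro g N x - kernel_op P (cesaro g N) x\<bar> = \<bar>?a 0 - ?a N\<bar> / real N"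
    by simp
  moreover have "\<bar>?a 0 - ?a N\<bar> \<le> 1"
    using unit_functionsD(2,3)[OF kernel_pow_unit[OF g], of _ x]
    by (smt (verit))
  ultimately show ?thesis by (simp add: divide_right_mono)
qed

lemma cesaro_mono:
  assumes sm: "stochastically_monotone le P" and g: "g \<in> unit_functions" and "monotone le (\<le>) g"
  shows "monotone le (\<le>) (cesaro g N)"
proof -
  have "monotone le (\<le>) ((kernel_op P ^^ n) g)" for n
  proof (induction n)
    case 0
    show ?case using assms(3) by simp
  next
    case (Suc n)
    have "(kernel_op P ^^ n) g \<in> borel_measurable borel" "range ((kernel_op P ^^ n) g) \<subseteq> {0..1}"
      using kernel_pow_unit[OF g, of n] by (simp_all add: unit_functions_def)
    then show ?case
      using sm Suc.IH by (simp add: stochastically_monotone_def kernel_op_def[abs_def])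
  qed
  then show ?thesis
    unfolding cesaro_def[abs_def] monotone_def
    by (intro allI impI divide_right_mono sum_mono) simp_all
qed

text \<open>A number \<open>c\<close> fits between the values of the increasing function \<open>cesaro g N\<close> on \<open>A\<close> and those on
  \<open>B\<close>. The maximum principle bounds the average at \<open>x\<close> by \<open>c\<close> from above and, applied to
  \<open>1 - cesaro g N\<close>, the average at \<open>y\<close> by \<open>c\<close> from below, up to the stated errors.\<close>
lemma cesaro_diff_bound:
  assumes sm: "stochastically_monotone le P" and g: "g \<in> unit_functions" "monotone le (\<le>) g"
    and AB: "A \<in> sets borel" "B \<in> sets borel" "set_le le A B" "A \<noteq> {}" "B \<noteq> {}"
  shows "cesaro g N x - cesaro g N y \<le> 2 * real k / real N + avoid A k x + avoid B k y"
proof -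
  let ?G = "cesaro g N"
  note U = cesaro_unit[OF g(1), of N]
  define c where "c = (SUP a\<in>A. ?G a)"
  have bdd: "bdd_above (?G ` A)" using unit_functionsD(3)[OF U] by (intro bdd_aboveI2)
  have cA: "?G a \<le> c" if "a \<in> A" for a
    unfolding c_def using that bdd by (intro cSUP_upper)
  have cB: "c \<le> ?G b" if "b \<in> B" for b
    unfolding c_def
  proof (rule cSUP_least[OF \<open>A \<noteq> {}\<close>])
    fix a assume "a \<in> A"
    then have "le a b" using AB(3) that unfolding set_le_def by blast
    then show "?G a \<le> ?G b" using cesaro_mono[OF sm g] by (rule monotoneD[rotated])
  qed
  obtain a b where "a \<in> A" "b \<in> B" using AB(4,5) by blast
  have c01: "0 \<le> c" "c \<le> 1"
    using cA[OF \<open>a \<in> A\<close>] cB[OF \<open>b \<in> B\<close>] unit_functionsD(2)[OF U, of a]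
      unit_functionsD(3)[OF U, of b] by linarith+
  have "?G x \<le> c + real k * (1 / real N) + avoid A k x"
  proof (rule bound_by_avoid[OF AB(1) U c01(1)])
    show "?G z \<le> 1 / real N + kernel_op P ?G z" for z
      using cesaro_almost_harmonic[OF g(1), of N z] by linarith
  qed (simp_all add: cA)
  moreover have "1 - ?G y \<le> (1 - c) + real k * (1 / real N) + avoid B k y"
  proof (rule bound_by_avoid[OF AB(2)])
    show "(\<lambda>z. 1 - ?G z) \<in> unit_functions"
      using unit_functionsD[OF U] by (intro unit_functionsI borel_measurable_diff) simp_all
    show "1 - ?G z \<le> 1 / real N + kernel_op P (\<lambda>z. 1 - ?G z) z" for z
    proof -
      interpret prob_space "P z" by (rule prob_space_kernel)
      have "kernel_op P (\<lambda>z. 1 - ?G z) z = 1 - kernel_op P ?G z"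
        using integrable_kernel[OF U, of z] by (simp add: kernel_op_def prob_space)
      then show ?thesis using cesaro_almost_harmonic[OF g(1), of N z] by linarith
    qed
  qed (simp_all add: cB c01)
  ultimately show ?thesis by simp
qed

lemma integral_cesaro_stationary:
  assumes \<pi>: "stationary_distribution P \<pi>" and g: "g \<in> unit_functions" and "N > 0"
  shows "(\<integral>x. cesaro g N x \<partial>\<pi>) = (\<integral>x. g x \<partial>\<pi>)"
proof -
  have p: "prob_space \<pi>" "sets \<pi> = sets borel" and inv: "\<pi> \<bind> P = \<pi>"
    using \<pi> by (simp_all add: stationary_distribution_def space_prob_algebra)
  interpret prob_space \<pi> by (rule p(1))
  have "(\<integral>x. (kernel_op P ^^ n) g x \<partial>\<pi>) = (\<integral>x. g x \<partial>\<pi>)" for n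
  proof (induction n)
    case (Suc n)
    have "(\<integral>x. (kernel_op P ^^ Suc n) g x \<partial>\<pi>) = (\<integral>x. (kernel_op P ^^ n) g x \<partial>(\<pi> \<bind> P))"
      using integral_bind_kernel[OF finite_measure_axioms p(2) kernel_pow_unit[OF g, of n]] by simp
    then show ?case using Suc.IH by (simp only: inv)
  qed simp
  moreover have "integrable \<pi> ((kernel_op P ^^ n) g)" for n
    by (rule integrable_unit_function[OF finite_measure_axioms p(2) kernel_pow_unit[OF g]])
  ultimately show ?thesis
    using \<open>N > 0\<close> unfolding cesaro_def[abs_def] integral_divide_zero
    by (subst Bochner_Integration.integral_sum) simp_all
qed

end
section \<open>Avoidance probabilities along a Markov chain\<close>

lemma markov_chainD:
  assumes "markov_chain P x M X"
  shows "prob_space M" "X k \<in> borel_measurable M" "AE \<omega> in M. X 0 \<omega> = x"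
    and "A \<in> sets borel \<Longrightarrow> AE \<omega> in M.
      real_cond_exp M (nat_filtration M X n) (indicat_real (X (Suc n) -` A \<inter> space M)) \<omega>
        = measure (P (X n \<omega>)) A"
  using assms unfolding markov_chain_def by simp_all

lemma subalgebra_nat_filtration:
  assumes "\<And>n. X n \<in> borel_measurable M"
  shows "subalgebra M (nat_filtration M X n)"
proof -
  have gen: "{X i -` A \<inter> space M | i A. i \<le> n \<and> A \<in> sets borel} \<subseteq> sets M"
    using measurable_sets[OF assms] by blast
  then show ?thesis
    unfolding subalgebra_def nat_filtration_def
    using sets.sigma_sets_subset[OF gen] sets.space_closed[of M]
    by (simp add: space_measure_of_conv sets_measure_of subset_trans[OF gen])
qed

lemma sets_nat_filtration_subset:
  assumes "\<And>n. X n \<in> borel_measurable M"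
  shows "sets (nat_filtration M X n) \<subseteq> sets M"
  using subalgebra_nat_filtration[OF assms] unfolding subalgebra_def by (rule conjunct2)

context kernel
begin

text \<open>The defining property of conditional expectation, integrated over an event \<open>D\<close> of the past.\<close>
lemma chain_one_step_measure:
  assumes mc: "markov_chain P x M X"
    and D: "D \<in> sets (nat_filtration M X n)" and A: "A \<in> sets borel"
  shows "(\<integral>\<omega>. indicator D \<omega> * indicat_real A (X (Suc n) \<omega>) \<partial>M)
    = (\<integral>\<omega>. indicator D \<omega> * measure (P (X n \<omega>)) A \<partial>M)"
proof -
  let ?F = "nat_filtration M X n" and ?E = "X (Suc n) -` A \<inter> space M"
  have X: "\<And>k. X k \<in> borel_measurable M"
    and ce: "AE \<omega> in M. real_cond_exp M ?F (indicat_real ?E) \<omega> = measure (P (X n \<omega>)) A"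
    using markov_chainD[OF mc] A by simp_all
  interpret prob_space M using mc by (rule markov_chainD)
  interpret finite_measure_subalgebra M ?F
    by unfold_locales (rule subalgebra_nat_filtration[OF X])
  have E: "?E \<in> sets M" using X A by (rule measurable_sets)
  have D': "D \<in> sets M" using D by (rule subsetD[OF sets_nat_filtration_subset[OF X]])
  have PA: "(\<lambda>\<omega>. measure (P (X n \<omega>)) A) \<in> borel_measurable M"
    using measurable_compose[OF X unit_functionsD(1)[OF kernel_op_unit[OF indicator_unit[OF A]]]]
    by (simp only: kernel_op_indicator[OF A])
  have "(\<integral>\<omega>. indicator D \<omega> * indicat_real A (X (Suc n) \<omega>) \<partial>M)
      = (\<integral>\<omega>\<in>D. indicat_real ?E \<omega> \<partial>M)"
    unfolding set_lebesgue_integral_def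
    by (intro Bochner_Integration.integral_cong) (simp_all add: indicator_def)
  also have "\<dots> = (\<integral>\<omega>\<in>D. real_cond_exp M ?F (indicat_real ?E) \<omega> \<partial>M)"
    by (rule real_cond_exp_intA[OF integrable_real_indicator[OF E] D]) (simp add: emeasure_eq_measure)
  also have "\<dots> = (\<integral>\<omega>. indicator D \<omega> * measure (P (X n \<omega>)) A \<partial>M)"
    unfolding set_lebesgue_integral_def real_scaleR_def
  proof (rule integral_cong_AE)
    show "AE \<omega> in M. indicator D \<omega> * real_cond_exp M ?F (indicat_real ?E) \<omega>
        = indicator D \<omega> * measure (P (X n \<omega>)) A"
      using ce by (rule AE_mp) simp
  qed (intro borel_measurable_times borel_measurable_indicator D' PA borel_measurable_cond_exp2)+
  finally show ?thesis .
qed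

text \<open>The passage from indicators to functions is made at the level of measures: with \<open>R k\<close> the
  distribution of \<open>X k\<close> under \<open>M\<close> restricted to \<open>D\<close>, the claim for indicators says that
  \<open>R (Suc n)\<close> is the image of \<open>R n\<close> under the kernel.\<close>
lemma chain_one_step:
  assumes mc: "markov_chain P x M X"
    and D: "D \<in> sets (nat_filtration M X n)" and f: "f \<in> unit_functions"
  shows "(\<integral>\<omega>. indicator D \<omega> * f (X (Suc n) \<omega>) \<partial>M)
    = (\<integral>\<omega>. indicator D \<omega> * kernel_op P f (X n \<omega>) \<partial>M)"
proof -
  have X: "\<And>k. X k \<in> borel_measurable M"
    using markov_chainD[OF mc] by simp
  interpret prob_space M using mc by (rule markov_chainD)
  have D': "D \<in> sets M" using D by (rule subsetD[OF sets_nat_filtration_subset[OF X]])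
  \<comment> \<open>\<open>R k\<close> has total mass \<open>prob D\<close>, possibly less than \<open>1\<close>.\<close>
  define R where "R k = distr (restrict_space M D) borel (X k)" for k
  have XR: "X k \<in> borel_measurable (restrict_space M D)" for k
    using X by (rule measurable_restrict_space1)
  have sets_R: "sets (R k) = sets borel" for k by (simp add: R_def)
  have fin_R: "finite_measure (R k)" for k
    unfolding R_def
    by (intro finite_measure.finite_measure_distr[OF _ XR] finite_measure_restrict_space)
       (simp_all add: D' finite_measure_axioms)
  have int_R: "(\<integral>y. h y \<partial>R k) = (\<integral>\<omega>. indicator D \<omega> * h (X k \<omega>) \<partial>M)"
    if "h \<in> unit_functions" for h k
    using unit_functionsD(1)[OF that] D'
    by (simp add: R_def integral_distr[OF XR] integral_restrict_space)
  have "R (Suc n) = R n \<bind> P"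
  proof (rule measure_eqI)
    have ne: "space (R n) \<noteq> {}" by (simp add: R_def)
    have PR: "P \<in> R n \<rightarrow>\<^sub>M subprob_algebra borel"
      using kernel_subprob by (simp add: measurable_cong_sets[OF sets_R refl])
    have sets_bind: "sets (R n \<bind> P) = sets borel"
      by (rule sets_bind[OF sets_kernel ne])
    then show "sets (R (Suc n)) = sets (R n \<bind> P)" by (simp add: sets_R)
    have fin_bind: "finite_measure (R n \<bind> P)"
    proof (rule finite_measureI)
      have "emeasure (R n \<bind> P) (space (R n \<bind> P)) = (\<integral>\<^sup>+x. emeasure (P x) (space (R n \<bind> P)) \<partial>R n)"
        by (rule emeasure_bind[OF ne PR]) (simp add: sets_bind[symmetric])
      also have "\<dots> \<le> (\<integral>\<^sup>+x. 1 \<partial>R n)"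
        by (intro nn_integral_mono prob_space.emeasure_le_1 prob_space_kernel)
      also have "\<dots> < \<infinity>" using finite_measure.emeasure_finite[OF fin_R] by (simp add: less_top)
      finally show "emeasure (R n \<bind> P) (space (R n \<bind> P)) \<noteq> \<infinity>" by simp
    qed
    fix A assume "A \<in> sets (R (Suc n))"
    then have A: "A \<in> sets borel" by (simp add: sets_R)
    note u = indicator_unit[OF A]
    have "measure (R (Suc n)) A = (\<integral>y. indicat_real A y \<partial>R (Suc n))"
      by (simp add: R_def)
    also have "\<dots> = (\<integral>\<omega>. indicator D \<omega> * indicat_real A (X (Suc n) \<omega>) \<partial>M)"
      by (rule int_R[OF u])
    also have "\<dots> = (\<integral>\<omega>. indicator D \<omega> * kernel_op P (indicat_real A) (X n \<omega>) \<partial>M)"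
      unfolding kernel_op_indicator[OF A] by (rule chain_one_step_measure[OF mc D A])
    also have "\<dots> = (\<integral>y. kernel_op P (indicat_real A) y \<partial>R n)"
      by (rule int_R[OF kernel_op_unit[OF u], symmetric])
    also have "\<dots> = (\<integral>y. indicat_real A y \<partial>(R n \<bind> P))"
      by (rule integral_bind_kernel[OF fin_R sets_R u, symmetric])
    also have "\<dots> = measure (R n \<bind> P) A"
      using sets_eq_imp_space_eq[OF sets_bind] by simp
    finally show "emeasure (R (Suc n)) A = emeasure (R n \<bind> P) A"
      by (simp add: finite_measure.emeasure_eq_measure[OF fin_R] finite_measure.emeasure_eq_measure[OF fin_bind])
  qed
  then show ?thesis
    using integral_bind_kernel[OF fin_R sets_R f, of n] int_R[OF f, of "Suc n"]
      int_R[OF kernel_op_unit[OF f], of n] by simp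
qed

text \<open>Peeling off one step of the recursion for \<open>avoid\<close> at a time trades one unit of \<open>k\<close> for one more
  time at which the path is required to be outside \<open>A\<close>.\<close>
lemma avoid_eq_prob:
  assumes mc: "markov_chain P x M X" and A: "A \<in> sets borel"
  shows "avoid A k x = measure M {\<omega> \<in> space M. \<forall>i<Suc k. X i \<omega> \<notin> A}"
proof -
  have X: "\<And>k. X k \<in> borel_measurable M" and X0: "AE \<omega> in M. X 0 \<omega> = x"
    using markov_chainD[OF mc] by simp_all
  interpret prob_space M using mc by (rule markov_chainD)
  define D where "D j = {\<omega> \<in> space M. \<forall>i<j. X i \<omega> \<notin> A}" for j
  have D_Suc: "D (Suc j) = D j \<inter> (X j -` (- A) \<inter> space M)" for j
    by (auto simp: D_def less_Suc_eq)
  have D_filt: "D (Suc j) \<in> sets (nat_filtration M X n)" if "j \<le> n" for j n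
    using that
  proof (induction j)
    have gen: "X i -` (- A) \<inter> space M \<in> sets (nat_filtration M X n)" if "i \<le> n" for i
      unfolding nat_filtration_def using that borel_comp[OF A] by (intro in_measure_of) auto
    have sp: "space M \<in> sets (nat_filtration M X n)"
      using sets.top[of "nat_filtration M X n"]
      by (simp add: nat_filtration_def space_measure_of_conv)
    {
      case 0
      have "D (Suc 0) = X 0 -` (- A) \<inter> space M" unfolding D_Suc by (auto simp: D_def)
      then show ?case using gen[of 0] 0 by simp
    next
      case (Suc j)
      then show ?case unfolding D_Suc[of "Suc j"] by (intro sets.Int gen) simp_all
    }
  qed
  have D_M: "D (Suc j) \<in> sets M" for j
    by (rule subsetD[OF sets_nat_filtration_subset[OF X] D_filt[OF order_refl]])
  \<comment> \<open>The event \<open>D j\<close> concerns the times before \<open>j\<close> and \<open>avoid\<close> the times \<open>j, \<dots>, j + k\<close>.\<close>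
  have *: "(\<integral>\<omega>. indicator (D j) \<omega> * avoid A k (X j \<omega>) \<partial>M) = measure M (D (Suc (j + k)))" for j k
  proof (induction k arbitrary: j)
    case 0
    have "(\<integral>\<omega>. indicator (D j) \<omega> * avoid A 0 (X j \<omega>) \<partial>M) = (\<integral>\<omega>. indicator (D (Suc j)) \<omega> \<partial>M)"
      by (intro Bochner_Integration.integral_cong) (simp_all add: D_Suc indicator_def)
    also have "\<dots> = measure M (D (Suc j))" using D_M[of j] sets.sets_into_space by (simp add: Int_absorb2)
    finally show ?case by simp
  next
    case (Suc k)
    have "(\<integral>\<omega>. indicator (D j) \<omega> * avoid A (Suc k) (X j \<omega>) \<partial>M)
        = (\<integral>\<omega>. indicator (D (Suc j)) \<omega> * kernel_op P (avoid A k) (X j \<omega>) \<partial>M)"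
      by (intro Bochner_Integration.integral_cong) (simp_all add: D_Suc indicator_def)
    also have "\<dots> = (\<integral>\<omega>. indicator (D (Suc j)) \<omega> * avoid A k (X (Suc j) \<omega>) \<partial>M)"
      by (rule chain_one_step[OF mc D_filt[OF order_refl] avoid_unit[OF A], symmetric])
    finally show ?case using Suc.IH[of "Suc j"] by simp
  qed
  have "avoid A k x = (\<integral>\<omega>. avoid A k x \<partial>M)" by (simp add: prob_space)
  also have "\<dots> = (\<integral>\<omega>. indicator (D 0) \<omega> * avoid A k (X 0 \<omega>) \<partial>M)"
  proof (rule integral_cong_AE)
    have D0: "D 0 = space M" by (simp add: D_def)
    show "(\<lambda>\<omega>. indicator (D 0) \<omega> * avoid A k (X 0 \<omega>)) \<in> borel_measurable M"
      unfolding D0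
      by (intro borel_measurable_times borel_measurable_indicator sets.top
          measurable_compose[OF X unit_functionsD(1)[OF avoid_unit[OF A]]])
    show "AE \<omega> in M. avoid A k x = indicator (D 0) \<omega> * avoid A k (X 0 \<omega>)"
      using X0 AE_space by eventually_elim (simp add: D0)
  qed simp
  finally show ?thesis using *[of 0 k] by (simp add: D_def)
qed

lemma avoid_tendsto_0:
  assumes mc: "markov_chain P x M X" and A: "A \<in> sets borel"
    and hit: "AE \<omega> in M. hitting_time X A \<omega> < \<infinity>"
  shows "(\<lambda>k. avoid A k x) \<longlonglongrightarrow> 0"
proof -
  have X: "\<And>k. X k \<in> borel_measurable M"
    using markov_chainD[OF mc] by simp
  interpret prob_space M using mc by (rule markov_chainD)
  define D where "D k = {\<omega> \<in> space M. \<forall>i<Suc k. X i \<omega> \<notin> A}" for k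
  have D_M: "D k \<in> sets M" for k
  proof -
    have "D k = (\<Inter>i\<in>{..<Suc k}. X i -` (- A) \<inter> space M)" by (auto simp: D_def)
    also have "\<dots> \<in> sets M"
      by (intro sets.finite_INT measurable_sets[OF X] borel_comp A) auto
    finally show ?thesis .
  qed
  have "decseq D" unfolding D_def decseq_def by fastforce
  then have "(\<lambda>k. measure M (D k)) \<longlonglongrightarrow> measure M (\<Inter>k. D k)"
    using D_M by (intro finite_Lim_measure_decseq) auto
  moreover have "measure M (\<Inter>k. D k) = 0"
  proof -
    have "AE \<omega> in M. \<omega> \<notin> (\<Inter>k. D k)"
      using hit
    proof eventually_elim
      fix \<omega> assume "hitting_time X A \<omega> < \<infinity>"
      then have "{n. X n \<omega> \<in> A} \<noteq> {}"
        unfolding hitting_time_def by (metis Inf_enat_def image_is_empty less_irrefl)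
      then show "\<omega> \<notin> (\<Inter>k. D k)" unfolding D_def by blast
    qed
    then have "AE \<omega> in M. \<omega> \<in> (\<Inter>k. D k) \<longleftrightarrow> \<omega> \<in> {}" by simp
    then have "measure M (\<Inter>k. D k) = measure M {}"
      using D_M by (intro finite_measure_eq_AE) auto
    then show ?thesis by simp
  qed
  ultimately show ?thesis
    unfolding D_def by (simp add: avoid_eq_prob[OF mc A])
qed

section \<open>Comparison of stationary distributions\<close>

text \<open>In \<open>cesaro_diff_bound\<close>, first \<open>k\<close> is taken large enough to make the two avoidance probabilities
  small, and then \<open>N\<close> large in comparison with \<open>k\<close>.\<close>
lemma cesaro_diff_pos_part_tendsto_0:
  assumes sm: "stochastically_monotone le P" and g: "g \<in> unit_functions" "monotone le (\<le>) g"
    and AB: "A \<in> sets borel" "B \<in> sets borel" "set_le le A B"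
    and A0: "(\<lambda>k. avoid A k x) \<longlonglongrightarrow> 0" and B0: "(\<lambda>k. avoid B k y) \<longlonglongrightarrow> 0"
  shows "(\<lambda>N. max 0 (cesaro g N x - cesaro g N y)) \<longlonglongrightarrow> 0"
proof (rule LIMSEQ_I)
  have avoid_empty: "avoid {} k z = 1" for k z
    by (induction k arbitrary: z) (simp_all add: kernel_op_def prob_space.prob_space[OF prob_space_kernel])
  \<comment> \<open>An empty target set would be avoided with probability \<open>1\<close> forever.\<close>
  have ne: "A \<noteq> {}" "B \<noteq> {}"
    using A0 B0 by (auto simp: avoid_empty LIMSEQ_const_iff)
  fix e :: real assume "0 < e"
  have "(\<lambda>k. avoid A k x + avoid B k y) \<longlonglongrightarrow> 0"
    using tendsto_add[OF A0 B0] by simp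
  then have "eventually (\<lambda>k. avoid A k x + avoid B k y < e / 2) sequentially"
    using \<open>0 < e\<close> by (intro order_tendstoD(2)[where y=0]) simp_all
  then obtain k where k: "avoid A k x + avoid B k y < e / 2"
    by (meson eventually_happens' sequentially_bot)
  have "(\<lambda>N. 2 * real k / real N) \<longlonglongrightarrow> 0" by (rule lim_const_over_n)
  then have "eventually (\<lambda>N. 2 * real k / real N < e / 2) sequentially"
    using \<open>0 < e\<close> by (intro order_tendstoD(2)[where y=0]) simp_all
  then obtain N\<^sub>0 where N\<^sub>0: "\<And>N. N \<ge> N\<^sub>0 \<Longrightarrow> 2 * real k / real N < e / 2"
    unfolding eventually_sequentially by blast
  show "\<exists>N\<^sub>0. \<forall>N\<ge>N\<^sub>0. norm (max 0 (cesaro g N x - cesaro g N y) - 0) < e"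
  proof (intro exI allI impI)
    fix N assume "N \<ge> N\<^sub>0"
    have "cesaro g N x - cesaro g N y < e"
      using cesaro_diff_bound[OF sm g AB ne, of N x y k] N\<^sub>0[OF \<open>N \<ge> N\<^sub>0\<close>] k by linarith
    then show "norm (max 0 (cesaro g N x - cesaro g N y) - 0) < e"
      using \<open>0 < e\<close> by simp
  qed
qed

text \<open>Stationarity makes the integral of \<open>cesaro g N\<close> the same for all \<open>N > 0\<close>. Hence the integral of
  \<open>cesaro g N x - cesaro g N y\<close> over the product of the two stationary distributions is a constant,
  while its positive part vanishes in the limit by dominated convergence; the constant is
  therefore at most \<open>0\<close>.\<close>
lemma integral_le_of_avoid_tendsto_0:
  assumes sm: "stochastically_monotone le P" and g: "g \<in> unit_functions" "monotone le (\<le>) g"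
    and \<pi>: "stationary_distribution P \<pi>" and \<rho>: "stationary_distribution P \<rho>"
    and hit: "\<And>x y. \<exists>A\<in>sets borel. \<exists>B\<in>sets borel. set_le le A B \<and>
      (\<lambda>k. avoid A k x) \<longlonglongrightarrow> 0 \<and> (\<lambda>k. avoid B k y) \<longlonglongrightarrow> 0"
  shows "(\<integral>x. g x \<partial>\<pi>) \<le> (\<integral>x. g x \<partial>\<rho>)"
proof -
  have p: "prob_space \<pi>" "sets \<pi> = sets borel" and r: "prob_space \<rho>" "sets \<rho> = sets borel"
    using \<pi> \<rho> by (simp_all add: stationary_distribution_def space_prob_algebra)
  interpret \<pi>: prob_space \<pi> by (rule p(1))
  interpret \<rho>: prob_space \<rho> by (rule r(1))
  interpret pair_prob_space \<pi> \<rho> by unfold_locales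
  let ?G = "\<lambda>N. cesaro g N" and ?Q = "\<pi> \<Otimes>\<^sub>M \<rho>"
  note U = unit_functionsD[OF cesaro_unit[OF g(1)]]
  have G_bd: "norm (?G N x - ?G N y) \<le> 1" for N x y
    using U(2,3)[of N x] U(2,3)[of N y] by (simp add: abs_le_iff)
  have G\<pi>: "?G N \<in> borel_measurable \<pi>" and G\<rho>: "?G N \<in> borel_measurable \<rho>" for N
    using U(1)[of N] by (simp_all add: measurable_cong_sets[OF p(2) refl] measurable_cong_sets[OF r(2) refl])
  have meas: "(\<lambda>z. ?G N (fst z) - ?G N (snd z)) \<in> borel_measurable ?Q" for N
    by (intro borel_measurable_diff measurable_compose[OF measurable_fst G\<pi>]
        measurable_compose[OF measurable_snd G\<rho>])
  have intg: "integrable ?Q (\<lambda>z. ?G N (fst z) - ?G N (snd z))" for N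
    by (intro integrable_const_bound[where B=1] AE_I2 G_bd meas)
  have diff: "(\<integral>z. ?G N (fst z) - ?G N (snd z) \<partial>?Q) = (\<integral>x. g x \<partial>\<pi>) - (\<integral>x. g x \<partial>\<rho>)"
    if "N > 0" for N
  proof -
    have i: "integrable \<pi> (?G N)" "integrable \<rho> (?G N)"
      by (rule integrable_unit_function cesaro_unit g(1) p(2) r(2)
          \<pi>.finite_measure_axioms \<rho>.finite_measure_axioms)+
    have "(\<integral>z. ?G N (fst z) - ?G N (snd z) \<partial>?Q) = (\<integral>x. (\<integral>y. ?G N x - ?G N y \<partial>\<rho>) \<partial>\<pi>)"
      using integral_fst'[OF intg[of N]] by simp
    also have "\<dots> = (\<integral>x. ?G N x \<partial>\<pi>) - (\<integral>y. ?G N y \<partial>\<rho>)"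
      using i by (simp add: \<pi>.prob_space \<rho>.prob_space)
    finally show ?thesis
      by (simp only: integral_cesaro_stationary[OF \<pi> g(1) that] integral_cesaro_stationary[OF \<rho> g(1) that])
  qed
  let ?f = "\<lambda>N z. max 0 (?G N (fst z) - ?G N (snd z))"
  have meas_f: "?f N \<in> borel_measurable ?Q" for N
    by (intro borel_measurable_max borel_measurable_const meas)
  have f_bd: "norm (?f N z) \<le> 1" for N z
    using G_bd[of N "fst z" "snd z"] by (simp add: abs_le_iff)
  have "(\<lambda>N. \<integral>z. ?f N z \<partial>?Q) \<longlonglongrightarrow> (\<integral>z. 0 \<partial>?Q)"
  proof (rule integral_dominated_convergence[where w="\<lambda>_. 1"])
    show "AE z in ?Q. (\<lambda>N. ?f N z) \<longlonglongrightarrow> 0"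
    proof (rule AE_I2)
      fix z
      obtain A B where "A \<in> sets borel" "B \<in> sets borel" "set_le le A B"
        "(\<lambda>k. avoid A k (fst z)) \<longlonglongrightarrow> 0" "(\<lambda>k. avoid B k (snd z)) \<longlonglongrightarrow> 0"
        using hit[of "fst z" "snd z"] by blast
      then show "(\<lambda>N. ?f N z) \<longlonglongrightarrow> 0" by (rule cesaro_diff_pos_part_tendsto_0[OF sm g])
    qed
    show "AE z in ?Q. norm (?f N z) \<le> 1" for N by (intro AE_I2 f_bd)
  qed (simp_all add: meas_f)
  then have "(\<lambda>N. \<integral>z. ?f N z \<partial>?Q) \<longlonglongrightarrow> 0" by simp
  moreover have "(\<integral>x. g x \<partial>\<pi>) - (\<integral>x. g x \<partial>\<rho>) \<le> (\<integral>z. ?f N z \<partial>?Q)" if "N > 0" for N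
    unfolding diff[OF that, symmetric]
    by (intro integral_mono intg integrable_const_bound[where B=1] AE_I2 f_bd meas_f) simp
  then have "\<exists>N\<^sub>0. \<forall>N\<ge>N\<^sub>0. (\<integral>x. g x \<partial>\<pi>) - (\<integral>x. g x \<partial>\<rho>) \<le> (\<integral>z. ?f N z \<partial>?Q)"
    by (intro exI[of _ 1]) simp
  ultimately have "(\<integral>x. g x \<partial>\<pi>) - (\<integral>x. g x \<partial>\<rho>) \<le> 0"
    by (rule LIMSEQ_le_const)
  then show ?thesis by simp
qed

end

theorem theorem5p1:
  fixes le :: "'a::polish_space \<Rightarrow> 'a \<Rightarrow> bool"
    and P :: "'a \<Rightarrow> 'a measure"
    and M :: "'a \<Rightarrow> 'w measure"
    and X :: "'a \<Rightarrow> nat \<Rightarrow> 'w \<Rightarrow> 'a"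
  assumes "ordered_polish le"
    and "markov_kernel P"
    and "stochastically_monotone le P"
    and "\<And>x. markov_chain P x (M x) (X x)"
    and "\<And>x y. \<exists>A \<in> sets borel. \<exists>B \<in> sets borel. set_le le A B \<and>
           (AE \<omega> in M x. hitting_time (X x) A \<omega> < \<infinity>) \<and>
           (AE \<omega> in M y. hitting_time (X y) B \<omega> < \<infinity>)"
  shows "\<exists>\<^sub>\<le>\<^sub>1 \<pi>. stationary_distribution P \<pi>"
proof (rule Uniq_I)
  interpret kernel P by unfold_locales (rule assms(2))
  have hit: "\<exists>A\<in>sets borel. \<exists>B\<in>sets borel. set_le le A B \<and>
      (\<lambda>k. avoid A k x) \<longlonglongrightarrow> 0 \<and> (\<lambda>k. avoid B k y) \<longlonglongrightarrow> 0" for x y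
  proof -
    obtain A B where AB: "A \<in> sets borel" "B \<in> sets borel" "set_le le A B"
      "AE \<omega> in M x. hitting_time (X x) A \<omega> < \<infinity>" "AE \<omega> in M y. hitting_time (X y) B \<omega> < \<infinity>"
      using assms(5)[of x y] by blast
    have "(\<lambda>k. avoid A k x) \<longlonglongrightarrow> 0"
      by (rule avoid_tendsto_0[OF assms(4) AB(1,4)])
    moreover have "(\<lambda>k. avoid B k y) \<longlonglongrightarrow> 0"
      by (rule avoid_tendsto_0[OF assms(4) AB(2,5)])
    ultimately show ?thesis using AB(1-3) by blast
  qed
  fix \<pi> \<rho> assume \<pi>: "stationary_distribution P \<pi>" and \<rho>: "stationary_distribution P \<rho>"
  show "\<rho> = \<pi>"
  proof (rule prob_measures_eq_if_eq_on_upper_sets[OF assms(1)])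
    show space: "\<rho> \<in> space (prob_algebra borel)" "\<pi> \<in> space (prob_algebra borel)"
      using \<pi> \<rho> by (simp_all add: stationary_distribution_def)
    fix U assume "U \<in> upper_sets le"
    then have "U \<in> sets borel" and up: "\<And>x y. x \<in> U \<Longrightarrow> le x y \<Longrightarrow> y \<in> U"
      unfolding upper_sets_def by blast+
    note g = indicator_unit[OF \<open>U \<in> sets borel\<close>]
    have mono: "monotone le (\<le>) (indicat_real U)"
      using up by (intro monotoneI) (simp add: indicator_def)
    have [simp]: "space \<rho> = UNIV" "space \<pi> = UNIV"
      using space by (simp_all add: space_prob_algebra sets_eq_imp_space_eq[of _ borel])
    \<comment> \<open>The comparison is used in both directions, which the hypothesis allows because it covers both \<open>(x, y)\<close> and \<open>(y, x)\<close>.\<close>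
    show "measure \<rho> U = measure \<pi> U"
      using integral_le_of_avoid_tendsto_0[OF assms(3) g mono \<pi> \<rho> hit]
        integral_le_of_avoid_tendsto_0[OF assms(3) g mono \<rho> \<pi> hit] by simp
  qed
qed

end
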